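(* Let $n$ be odd with $2n+1$ prime, and let $g$ be a primitive root modulo $2n+1$. For $i = 1, 2, \ldots, n$ let $c_i \in \mathbb{Z}_{2n}$ be the discrete logarithm of $i$ to base $g$ (i.e. $g^{c_i} \equiv i \pmod{2n+1}$), and let $d_i \in \mathbb{Z}_n$ be the reduction of $c_i$ modulo $n$. Then $(d_1, d_2, \ldots, d_n)$ is an ODC-starter for $\mathbb{Z}_n$.
   Context: Write $n = 2m+1$ and view the vertices of $K_n$ as the elements of the cyclic group $\mathbb{Z}_n=\{0,1,\dots,n-1\}$. The length of the edge between vertices $x$ and $y$ is the set $\{y-x, x-y\} = \pm(y-x)$. A Hamiltonian path in $K_n$ (equivalently, an arrangement $(h_1,\dots,h_n)$ of all elements of $\mathbb{Z}_n$, with edges $\{h_t,h_{t+1}\}$) is a terrace for $\mathbb{Z}_n$ if each edge length $\pm \ell$, for $\ell \in \{1, 2, \ldots, m\}$, occurs exactly twice among its edges. The distance between two edges $\{x_1,y_1\}$ and $\{x_2,y_2\}$ of the same length is $\pm k$ if either $\{x_1+k, y_1+k\} = \{x_2,y_2\}$ or $\{x_1-k,y_1-k\}=\{x_2,y_2\}$. A terrace is an ODC-starter for $\mathbb{Z}_n$ if every distance $\pm k$, for $k \in \{1, 2, \ldots, m\}$, occurs as the distance between the two edges of some common length $\pm\ell$. *)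

theory Defs
  imports "HOL-Number_Theory.Number_Theory"
begin

text \<open>
  The cyclic group of order \<open>n\<close> is represented by its least residues \<open>{0..<int n}\<close>, with
  addition and subtraction taken \<open>mod int n\<close>. An arrangement \<open>(h\<^sub>1, ..., h\<^sub>n)\<close> is a function
  \<open>h\<close> of which only the values at \<open>1, ..., n\<close> matter. An edge of the complete graph on the
  residues is the two-element set of its endpoints.
\<close>

definition plus_minus :: "nat \<Rightarrow> int \<Rightarrow> int set" where
  "plus_minus n a = {a mod int n, (- a) mod int n}"

text \<open>For an edge \<open>{x, y}\<close> with \<open>x \<noteq> y\<close> the following is the set \<open>{y - x, x - y}\<close>.\<close>

definition edge_length :: "nat \<Rightarrow> int set \<Rightarrow> int set" where
  "edge_length n e = {(y - x) mod int n | x y. x \<in> e \<and> y \<in> e \<and> x \<noteq> y}"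

definition translate :: "nat \<Rightarrow> int \<Rightarrow> int set \<Rightarrow> int set" where
  "translate n k e = (\<lambda>x. (x + k) mod int n) ` e"

definition edges_at_distance :: "nat \<Rightarrow> int \<Rightarrow> int set \<Rightarrow> int set \<Rightarrow> bool" where
  "edges_at_distance n k e f \<longleftrightarrow> translate n k e = f \<or> translate n (- k) e = f"

definition hamiltonian_path :: "nat \<Rightarrow> (nat \<Rightarrow> int) \<Rightarrow> bool" where
  "hamiltonian_path n h \<longleftrightarrow> bij_betw h {1..n} {0..<int n}"

definition path_edges :: "nat \<Rightarrow> (nat \<Rightarrow> int) \<Rightarrow> int set set" where
  "path_edges n h = (\<lambda>t. {h t, h (t + 1)}) ` {1..<n}"

text \<open>
  The next two notions are only meant for odd \<open>n = 2 * m + 1\<close>, so that \<open>m = (n - 1) div 2\<close>.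
\<close>

definition terrace :: "nat \<Rightarrow> (nat \<Rightarrow> int) \<Rightarrow> bool" where
  "terrace n h \<longleftrightarrow> odd n \<and> hamiltonian_path n h \<and>
     (\<forall>l\<in>{1..(n - 1) div 2}.
        card {e \<in> path_edges n h. edge_length n e = plus_minus n (int l)} = 2)"

definition ODC_starter :: "nat \<Rightarrow> (nat \<Rightarrow> int) \<Rightarrow> bool" where
  "ODC_starter n h \<longleftrightarrow> terrace n h \<and>
     (\<forall>k\<in>{1..(n - 1) div 2}. \<exists>l\<in>{1..(n - 1) div 2}.
        \<exists>e\<in>path_edges n h. \<exists>f\<in>path_edges n h. e \<noteq> f \<and>
          edge_length n e = plus_minus n (int l) \<and>
          edge_length n f = plus_minus n (int l) \<and>
          edges_at_distance n (int k) e f)"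

text \<open>
  The discrete logarithm of \<open>a\<close> to base \<open>g\<close>, as a least residue modulo \<open>p - 1\<close>. It is
  well-defined when \<open>p\<close> is prime, \<open>g\<close> is a primitive root modulo \<open>p\<close> and \<open>p\<close> does not
  divide \<open>a\<close>.
\<close>

definition discrete_log :: "nat \<Rightarrow> nat \<Rightarrow> nat \<Rightarrow> nat" where
  "discrete_log p g a = (THE c. c < p - 1 \<and> [g ^ c = a] (mod p))"

end

theory Submission
  imports Defs
begin

text \<open>
  Put \<open>p = 2n + 1\<close>. The logarithm modulo \<open>n\<close> identifies \<open>GF(p)\<^sup>* / {1, -1}\<close> with \<open>\<int>\<^sub>n\<close>, and
  \<open>1, ..., n\<close> represent the quotient. Extend the path edges to \<open>E(a) = {log a, log (a + 1)}\<close> for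
  all \<open>a\<close> modulo \<open>p\<close> with \<open>a \<noteq> 0, -1, -1/2\<close>; since \<open>E(-1 - a) = E(a)\<close>, no new edges arise.
  The edges of length \<open>log x\<close> are \<open>E(1/(x - 1))\<close> and \<open>E(-1/(x + 1))\<close>, so there are two of them.
  For \<open>y \<noteq> 0, 1, -1\<close> and \<open>a = (y - 1)/2\<close> one has \<open>-a/y + 1 = (a + 1)/y\<close>, so \<open>E(-a/y)\<close> is the
  translate of \<open>E(a)\<close> by \<open>-log y\<close>: every distance occurs.
\<close>

section \<open>Discrete logarithms, and lengths of edges in the cyclic group\<close>

text \<open>The powers of \<open>g\<close> with exponents below \<open>p - 1\<close> run through the
  totatives of \<open>p\<close> once each, so exactly one exponent meets the definite
  description.\<close>

lemma discrete_log_spec: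
  assumes "prime p" "residue_primroot p g" "\<not> p dvd a"
  shows "discrete_log p g a < p - 1" "[g ^ discrete_log p g a = a] (mod p)"
proof -
  have gen: "bij_betw (\<lambda>i. g ^ i mod p) {..<p - 1} (totatives p)"
    using residue_primroot_is_generator[OF prime_gt_1_nat[OF assms(1)] assms(2)]
    by (simp add: totient_prime[OF assms(1)])
  have "a mod p \<in> totatives p"
    using assms(3) prime_gt_0_nat[OF assms(1)]
    by (simp add: totatives_prime[OF assms(1)] dvd_eq_mod_eq_0)
  then have "a mod p \<in> (\<lambda>i. g ^ i mod p) ` {..<p - 1}"
    by (simp only: bij_betw_imp_surj_on[OF gen])
  then have "\<exists>c<p - 1. g ^ c mod p = a mod p"
    by force
  then have "\<exists>!c. c < p - 1 \<and> [g ^ c = a] (mod p)"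
    using bij_betw_imp_inj_on[OF gen] by (auto simp: cong_def inj_on_def)
  from theI'[OF this] show "discrete_log p g a < p - 1" "[g ^ discrete_log p g a = a] (mod p)"
    by (auto simp: discrete_log_def)
qed

lemma plus_minus_eq_iff:
  "plus_minus n a = plus_minus n b \<longleftrightarrow> [a = b] (mod int n) \<or> [a = - b] (mod int n)"
  unfolding plus_minus_def doubleton_eq_iff
  by (auto simp: cong_def dest: mod_minus_cong)

lemma edge_length_doubleton:
  assumes "u \<noteq> v"
  shows "edge_length n {u, v} = plus_minus n (v - u)"
  using assms by (auto simp: edge_length_def plus_minus_def)

text \<open>Of the least residue \<open>r\<close> of \<open>a\<close> and \<open>n - r\<close>,
  which is the residue of \<open>- a\<close>, one is at most \<open>(n - 1) div 2\<close>, because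
  \<open>n\<close> is odd.\<close>

lemma ex_plus_minus_eq:
  assumes "\<not> [a = 0] (mod int n)" "odd n"
  shows "\<exists>l\<in>{1..(n - 1) div 2}. plus_minus n a = plus_minus n (int l)"
proof -
  define r where "r = a mod int n"
  have n: "n > 0" using assms(2) by (cases n) auto
  have r: "0 < r" "r < int n" "[a = r] (mod int n)"
    using assms n by (auto simp: r_def cong_def order.not_eq_order_implies_strict)
  have neg: "[a = - int (nat (int n - r))] (mod int n)"
    using r by (simp add: cong_def algebra_simps)
  show ?thesis
  proof (cases "r \<le> int ((n - 1) div 2)")
    case True
    then show ?thesis using r
      by (intro bexI[of _ "nat r"]) (auto simp: plus_minus_eq_iff)
  next
    case False
    then show ?thesis using r neg assms(2)
      by (intro bexI[of _ "nat (int n - r)"]) (auto simp: plus_minus_eq_iff elim!: oddE)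
  qed
qed

section \<open>The logarithm modulo \<open>n\<close> as a homomorphism with kernel 1 and -1\<close>

locale odd_log =
  fixes n g :: nat
  assumes odd_n: "odd n"
    and prime_p: "prime (2 * n + 1)"
    and primroot: "residue_primroot (2 * n + 1) g"
begin

abbreviation P :: int where "P \<equiv> 2 * int n + 1"

text \<open>Taking integer arguments modulo \<open>P\<close> gives meaning to the logarithms of
  negative numbers and of products. Multiples of \<open>P\<close> get an unspecified common
  value.\<close>

definition L :: "int \<Rightarrow> int" where
  "L a = int (discrete_log (2 * n + 1) g (nat (a mod P))) mod int n"

lemma n_pos: "n > 0"
  using odd_n by (cases n) auto

lemma P_eq: "P = int (2 * n + 1)"
  by simp

lemma prime_P: "prime P"
  unfolding P_eq using prime_p by (simp only: prime_nat_int_transfer)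

lemma P_dvd_mult_iff: "P dvd a * b \<longleftrightarrow> P dvd a \<or> P dvd b"
  using prime_P by (rule prime_dvd_mult_iff)

lemma not_P_dvd_2: "\<not> P dvd 2"
  using n_pos zdvd_not_zless[of 2 P] by simp

lemma not_P_dvd_1: "\<not> P dvd 1"
  using n_pos zdvd_not_zless[of 1 P] by simp

lemma square_cong_iff:
  "[a\<^sup>2 = b\<^sup>2] (mod P) \<longleftrightarrow> P dvd a - b \<or> P dvd a + b"
proof -
  have "a\<^sup>2 - b\<^sup>2 = (a - b) * (a + b)" for a b :: int
    by (simp add: power2_eq_square algebra_simps)
  then show ?thesis by (simp add: cong_iff_dvd_diff P_dvd_mult_iff)
qed

text \<open>A primitive root has order \<open>2 * n\<close>, the totient of the prime
  \<open>2 * n + 1\<close>.\<close>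

lemma power_g_cong_iff: "[int g ^ e = int g ^ f] (mod P) \<longleftrightarrow> [e = f] (mod 2 * n)"
proof -
  have "[int g ^ e = int g ^ f] (mod P) \<longleftrightarrow> [g ^ e = g ^ f] (mod 2 * n + 1)"
    using cong_int_iff[of "g ^ e" "g ^ f" "2 * n + 1"] by (simp add: add.commute)
  also have "\<dots> \<longleftrightarrow> [e = f] (mod 2 * n)"
    using primroot order_divides_expdiff[of "2 * n + 1" g e f] totient_prime[OF prime_p]
    by (simp add: residue_primroot_def)
  finally show ?thesis .
qed

lemma not_P_dvd_power_g: "\<not> P dvd int g ^ e"
proof -
  have "\<not> P dvd int g"
  proof
    assume "P dvd int g"
    then have "2 * n + 1 dvd g"
      unfolding P_eq by (simp only: int_dvd_int_iff)
    then show False using primroot prime_p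
      by (auto simp: residue_primroot_def coprime_absorb_left)
  qed
  then show ?thesis using prime_P prime_dvd_power by blast
qed

lemma L_exponent:
  assumes "\<not> P dvd a"
  obtains e where "L a = int e mod int n" "[int g ^ e = a] (mod P)"
proof
  let ?e = "discrete_log (2 * n + 1) g (nat (a mod P))"
  show "L a = int ?e mod int n" by (simp add: L_def)
  have nn: "0 \<le> a mod P" by simp
  have "\<not> 2 * n + 1 dvd nat (a mod P)"
  proof
    assume "2 * n + 1 dvd nat (a mod P)"
    then have "int (2 * n + 1) dvd int (nat (a mod P))" by (simp only: int_dvd_int_iff)
    then have "P dvd a mod P" using nn by (simp add: add.commute)
    then show False using assms by (simp add: dvd_mod_iff)
  qed
  then have "[g ^ ?e = nat (a mod P)] (mod 2 * n + 1)"
    by (rule discrete_log_spec(2)[OF prime_p primroot])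
  then have "[int (g ^ ?e) = int (nat (a mod P))] (mod int (2 * n + 1))"
    by (simp only: cong_int_iff)
  then show "[int g ^ ?e = a] (mod P)" using nn by (simp add: cong_def add.commute)
qed

lemma L_cong: "[a = b] (mod P) \<Longrightarrow> L a = L b"
  by (simp add: L_def cong_def)

text \<open>Any exponent representing \<open>a\<close> will do: two of them agree modulo
  \<open>2 * n\<close>, hence modulo \<open>n\<close>.\<close>

lemma L_eqI:
  assumes "\<not> P dvd a" "[int g ^ e = a] (mod P)"
  shows "L a = int e mod int n"
proof -
  obtain f where f: "L a = int f mod int n" "[int g ^ f = a] (mod P)"
    using L_exponent[OF assms(1)] .
  then have "[int g ^ f = int g ^ e] (mod P)" using assms(2) cong_sym cong_trans by blast
  then have "[f = e] (mod 2 * n)" by (simp add: power_g_cong_iff)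
  then have "[f = e] (mod n)" using cong_modulus_mult_nat[of f e n 2] by (simp add: mult.commute)
  then have "[int f = int e] (mod int n)" by (simp add: cong_int_iff)
  then show ?thesis using f by (simp add: cong_def)
qed

lemma L_mult:
  assumes "\<not> P dvd a" "\<not> P dvd b"
  shows "L (a * b) = (L a + L b) mod int n"
proof -
  obtain e where e: "L a = int e mod int n" "[int g ^ e = a] (mod P)"
    using L_exponent[OF assms(1)] .
  obtain f where f: "L b = int f mod int n" "[int g ^ f = b] (mod P)"
    using L_exponent[OF assms(2)] .
  have "L (a * b) = int (e + f) mod int n"
    using cong_mult[OF e(2) f(2)] assms
    by (intro L_eqI) (auto simp: power_add P_dvd_mult_iff)
  then show ?thesis using e f by (simp add: mod_add_eq)
qed

text \<open>Exponents agree modulo \<open>n\<close> exactly when their doubles agree modulo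
  \<open>2 * n\<close>, and doubling the exponent squares the power of \<open>g\<close>. Thus
  \<open>L\<close> determines its argument up to sign.\<close>

lemma L_eq_iff:
  assumes "\<not> P dvd a" "\<not> P dvd b"
  shows "L a = L b \<longleftrightarrow> [a\<^sup>2 = b\<^sup>2] (mod P)"
proof -
  obtain e where e: "L a = int e mod int n" "[int g ^ e = a] (mod P)"
    using L_exponent[OF assms(1)] .
  obtain f where f: "L b = int f mod int n" "[int g ^ f = b] (mod P)"
    using L_exponent[OF assms(2)] .
  have "[int g ^ (2 * e) = a\<^sup>2] (mod P)" "[int g ^ (2 * f) = b\<^sup>2] (mod P)"
    using cong_pow[OF e(2), of 2] cong_pow[OF f(2), of 2] by (simp_all add: power_mult mult.commute)
  then have "[a\<^sup>2 = b\<^sup>2] (mod P) \<longleftrightarrow> [int g ^ (2 * e) = int g ^ (2 * f)] (mod P)"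
    by (simp add: cong_def)
  also have "\<dots> \<longleftrightarrow> 2 * e mod (2 * n) = 2 * f mod (2 * n)"
    unfolding power_g_cong_iff by (simp only: cong_def)
  also have "\<dots> \<longleftrightarrow> [e = f] (mod n)"
    by (simp add: cong_def mult_mod_right[symmetric])
  also have "\<dots> \<longleftrightarrow> [int e = int f] (mod int n)" by (simp add: cong_int_iff)
  also have "\<dots> \<longleftrightarrow> L a = L b" using e f by (simp add: cong_def)
  finally show ?thesis ..
qed

lemma L_uminus: "L (- a) = L a"
proof (cases "P dvd a")
  case True
  then show ?thesis by (intro L_cong) (simp add: cong_iff_dvd_diff)
next
  case False
  then show ?thesis by (simp add: L_eq_iff)
qed

lemma L_one: "L 1 = 0"
  using L_eqI[of 1 0] not_P_dvd_1 by simp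

lemma L_mod: "L a mod int n = L a"
  by (simp add: L_def)

lemma L_bounds: "0 \<le> L a" "L a < int n"
  using n_pos by (simp_all add: L_def)

lemma L_surj:
  assumes "0 \<le> k" "k < int n"
  obtains x where "\<not> P dvd x" "L x = k"
proof
  show "\<not> P dvd int g ^ nat k" by (rule not_P_dvd_power_g)
  then show "L (int g ^ nat k) = k"
    using L_eqI[of "int g ^ nat k" "nat k"] assms by simp
qed

lemma L_eq_0_iff:
  assumes "\<not> P dvd a"
  shows "L a = 0 \<longleftrightarrow> P dvd a - 1 \<or> P dvd a + 1"
  using L_eq_iff[OF assms not_P_dvd_1] L_one square_cong_iff[of a 1]
  by simp

lemma not_P_dvd_small: "0 < a \<Longrightarrow> a < P \<Longrightarrow> \<not> P dvd a"
  using zdvd_not_zless by blast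

text \<open>Equal logarithms force \<open>i = j\<close> or \<open>i = - j\<close> modulo
  \<open>P\<close>; the second is impossible since \<open>i + j\<close> lies strictly between 0 and
  \<open>P\<close>.\<close>

lemma inj_on_L: "inj_on (\<lambda>i::nat. L (int i)) {1..n}"
proof (rule inj_onI)
  fix i j :: nat assume ij: "i \<in> {1..n}" "j \<in> {1..n}" "L (int i) = L (int j)"
  have "\<not> P dvd int i" "\<not> P dvd int j" "\<not> P dvd int i + int j"
    using ij by (simp_all add: not_P_dvd_small)
  then have "P dvd int i - int j"
    using ij L_eq_iff[of "int i" "int j"] by (simp add: square_cong_iff)
  moreover have "\<bar>int i - int j\<bar> < P" using ij by auto
  ultimately have "int i - int j = 0" using dvd_imp_le_int[of "int i - int j" P] by linarith
  then show "i = j" by simp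
qed

lemma bij_betw_L: "bij_betw (\<lambda>i::nat. L (int i)) {1..n} {0..<int n}"
proof -
  have "card ((\<lambda>i::nat. L (int i)) ` {1..n}) = n"
    using card_image[OF inj_on_L] by simp
  then have "(\<lambda>i::nat. L (int i)) ` {1..n} = {0..<int n}"
    by (intro card_subset_eq) (auto simp: L_bounds)
  then show ?thesis using inj_on_L by (simp add: bij_betw_def)
qed

section \<open>Path edges parametrized by residues modulo \<open>P\<close>\<close>

definition edge :: "int \<Rightarrow> int set" where
  "edge a = {L a, L (a + 1)}"

lemma edge_cong: "[a = b] (mod P) \<Longrightarrow> edge a = edge b"
  using L_cong[of a b] L_cong[of "a + 1" "b + 1"] cong_add[OF _ cong_refl, of a b P 1]
  by (simp add: edge_def)

text \<open>Up to sign, which \<open>L\<close> ignores, the reflection swaps \<open>a\<close> and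
  \<open>a + 1\<close>.\<close>

lemma edge_reflect: "edge (- 1 - a) = edge a"
proof -
  have "- 1 - a = - (a + 1)" "- 1 - a + 1 = - a" by simp_all
  then have "L (- 1 - a) = L (a + 1)" "L (- 1 - a + 1) = L a" by (simp_all only: L_uminus)
  then show ?thesis by (auto simp: edge_def)
qed

text \<open>The excluded values are those for which \<open>edge a\<close> is a loop or involves the junk value \<open>L 0\<close>.\<close>
definition nondegenerate :: "int \<Rightarrow> bool" where
  "nondegenerate a \<longleftrightarrow> \<not> P dvd a \<and> \<not> P dvd a + 1 \<and> \<not> P dvd 2 * a + 1"

lemma nondegenerate_index:
  assumes "i \<in> {1..<n}"
  shows "nondegenerate (int i)"
  using assms unfolding nondegenerate_def by (simp add: not_P_dvd_small)

text \<open>Nondegeneracy removes the least residues 0, \<open>n\<close> and \<open>2 * n\<close>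
  (that is, 0, -1/2 and -1). The reflection \<open>r\<close> to \<open>2 * n - r\<close> moves the
  remaining ones above \<open>n\<close> into the range below \<open>n\<close>.\<close>

lemma nondegenerate_rep:
  assumes "nondegenerate a"
  obtains i where "i \<in> {1..<n}" "[int i = a] (mod P) \<or> [int i = - 1 - a] (mod P)"
proof -
  define r where "r = a mod P"
  have r: "0 \<le> r" "r < P" "[r = a] (mod P)"
    using n_pos pos_mod_bound[of P a] by (simp_all add: r_def cong_def)
  obtain q where q: "a = r + P * q"
    by (metis mod_mult_div_eq r_def)
  have "r \<noteq> 0"
    using assms by (auto simp: q nondegenerate_def)
  moreover have "r \<noteq> 2 * int n"
  proof
    assume "r = 2 * int n"
    then have "a + 1 = P * (q + 1)" by (simp add: q algebra_simps)
    then show False using assms by (simp add: nondegenerate_def)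
  qed
  moreover have "r \<noteq> int n"
  proof
    assume "r = int n"
    then have "2 * a + 1 = P * (2 * q + 1)" by (simp add: q algebra_simps)
    then show False using assms by (simp add: nondegenerate_def)
  qed
  ultimately consider "r \<in> {1..<int n}" | "2 * int n - r \<in> {1..<int n}"
    using r by fastforce
  then show thesis
  proof cases
    case 1
    then show thesis using that[of "nat r"] r by (simp add: nat_le_iff le_nat_iff nat_less_iff)
  next
    case 2
    have "2 * int n - r - (- 1 - a) = P * (q + 1)"
      by (simp add: q algebra_simps)
    then have "[2 * int n - r = - 1 - a] (mod P)"
      by (simp add: cong_iff_dvd_diff)
    then show thesis using that[of "nat (2 * int n - r)"] 2 by (simp add: le_nat_iff nat_less_iff)
  qed
qed

text \<open>The squares of \<open>a + 1\<close> and \<open>a\<close> differ by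
  \<open>2 * a + 1\<close>.\<close>

lemma L_succ_neq:
  assumes "nondegenerate a"
  shows "L (a + 1) \<noteq> L a"
proof -
  have "a + 1 + a = 2 * a + 1" by simp
  then have "\<not> [(a + 1)\<^sup>2 = a\<^sup>2] (mod P)"
    unfolding square_cong_iff
    using assms not_P_dvd_1 by (simp add: nondegenerate_def)
  then show ?thesis using assms L_eq_iff by (simp add: nondegenerate_def)
qed

lemma edge_length_edge:
  assumes "nondegenerate a"
  shows "edge_length n (edge a) = plus_minus n (L (a + 1) - L a)"
  unfolding edge_def using L_succ_neq[OF assms] by (intro edge_length_doubleton) simp

lemma path_edges_eq:
  assumes "\<And>i. i \<in> {1..n} \<Longrightarrow> d i = L (int i)"
  shows "path_edges n d = {edge a | a. nondegenerate a}"
proof -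
  have "path_edges n d = (\<lambda>i. edge (int i)) ` {1..<n}"
    unfolding path_edges_def edge_def using assms by (intro image_cong) (auto simp: add.commute)
  also have "\<dots> = {edge a | a. nondegenerate a}"
  proof (intro equalityI subsetI)
    fix e assume "e \<in> {edge a | a. nondegenerate a}"
    then obtain a where a: "e = edge a" "nondegenerate a" by auto
    then obtain i where i: "i \<in> {1..<n}" "[int i = a] (mod P) \<or> [int i = - 1 - a] (mod P)"
      using nondegenerate_rep by blast
    then have "edge (int i) = edge a"
      using edge_cong edge_reflect by metis
    then show "e \<in> (\<lambda>i. edge (int i)) ` {1..<n}" using a i by auto
  qed (use nondegenerate_index in auto)
  finally show ?thesis .
qed

section \<open>The two edges of a given length\<close>

lemma inverse_exists:
  assumes "\<not> P dvd a"
  obtains b where "[a * b = 1] (mod P)"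
proof -
  have "coprime a P" using prime_imp_coprime[OF prime_P assms] by (simp add: coprime_commute)
  then show thesis using cong_solve_coprime_int that by blast
qed

lemma not_P_dvd_inverse:
  assumes "[a * b = 1] (mod P)"
  shows "\<not> P dvd a" "\<not> P dvd b"
  using cong_dvd_iff[OF assms] not_P_dvd_1 by (auto simp: P_dvd_mult_iff)

lemma cong_inverse_iff:
  assumes "[u * s = 1] (mod P)"
  shows "[u * a = c] (mod P) \<longleftrightarrow> [a = s * c] (mod P)"
proof -
  have "P dvd c * (u * s - 1)" using assms by (simp add: cong_iff_dvd_diff)
  moreover have "u * (a - s * c) = u * a - c - c * (u * s - 1)" by (simp add: algebra_simps)
  ultimately have "P dvd u * (a - s * c) \<longleftrightarrow> P dvd u * a - c"
    by (simp add: dvd_diff_left_iff)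
  then show ?thesis using not_P_dvd_inverse[OF assms] by (simp add: cong_iff_dvd_diff P_dvd_mult_iff)
qed

text \<open>The length condition says that the quotient of \<open>a + 1\<close> and
  \<open>a\<close>, in one order or the other, is \<open>x\<close> up to sign. These are four linear
  congruences in \<open>a\<close>, solved by dividing by \<open>x - 1\<close> or
  \<open>x + 1\<close>. The last two are the first two with \<open>a\<close> replaced by its
  reflection \<open>- 1 - a\<close>.\<close>

lemma edge_length_edge_iff:
  assumes "nondegenerate a" "\<not> P dvd x"
    and s: "[(x - 1) * s = 1] (mod P)" and t: "[(x + 1) * t = 1] (mod P)"
  shows "edge_length n (edge a) = plus_minus n (L x) \<longleftrightarrow>
    [a = s] (mod P) \<or> [a = - t] (mod P) \<or> [- 1 - a = s] (mod P) \<or> [- 1 - a = - t] (mod P)"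
proof -
  have a: "\<not> P dvd a" "\<not> P dvd a + 1" using assms by (auto simp: nondegenerate_def)
  have "edge_length n (edge a) = plus_minus n (L x) \<longleftrightarrow>
     [L (a + 1) = L a + L x] (mod int n) \<or> [L (a + 1) + L x = L a] (mod int n)"
    unfolding edge_length_edge[OF assms(1)] plus_minus_eq_iff cong_iff_dvd_diff
    by (simp add: algebra_simps)
  also have "\<dots> \<longleftrightarrow> L (a + 1) = L (a * x) \<or> L ((a + 1) * x) = L a"
    using assms(2) a by (simp add: L_mult cong_def L_mod)
  also have "\<dots> \<longleftrightarrow> [(a + 1)\<^sup>2 = (a * x)\<^sup>2] (mod P) \<or> [((a + 1) * x)\<^sup>2 = a\<^sup>2] (mod P)"
    using assms(2) a by (simp add: L_eq_iff P_dvd_mult_iff)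
  also have "\<dots> \<longleftrightarrow> P dvd (a + 1) - a * x \<or> P dvd (a + 1) + a * x \<or>
      P dvd (a + 1) * x - a \<or> P dvd (a + 1) * x + a"
    by (simp add: square_cong_iff)
  also have "P dvd (a + 1) - a * x \<longleftrightarrow> [(x - 1) * a = 1] (mod P)"
    unfolding cong_iff_dvd_diff by (subst dvd_diff_commute) (simp add: algebra_simps)
  also have "P dvd (a + 1) + a * x \<longleftrightarrow> [(x + 1) * a = - 1] (mod P)"
    unfolding cong_iff_dvd_diff by (simp add: algebra_simps)
  also have "P dvd (a + 1) * x - a \<longleftrightarrow> [(x - 1) * (- 1 - a) = 1] (mod P)"
    unfolding cong_iff_dvd_diff by (subst dvd_minus_iff[symmetric]) (simp add: algebra_simps)
  also have "P dvd (a + 1) * x + a \<longleftrightarrow> [(x + 1) * (- 1 - a) = - 1] (mod P)"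
    unfolding cong_iff_dvd_diff by (subst dvd_minus_iff[symmetric]) (simp add: algebra_simps)
  finally show ?thesis
    unfolding cong_inverse_iff[OF s] cong_inverse_iff[OF t] by auto
qed

text \<open>Since \<open>n\<close> is odd, 2 is a unit. This serves to refute coincidences of two
  edges whose endpoints match crosswise.\<close>

lemma two_mult_cong_0_iff: "[2 * k = 0] (mod int n) \<longleftrightarrow> [k = 0] (mod int n)"
proof -
  have "coprime (int n) 2" using odd_n by simp
  then show ?thesis by (simp add: cong_0_iff coprime_dvd_mult_right_iff)
qed

lemma card_edges_of_length:
  assumes l: "l \<in> {1..(n - 1) div 2}"
  shows "card {e \<in> {edge a | a. nondegenerate a}. edge_length n e = plus_minus n (int l)} = 2"
proof -
  obtain x where x: "\<not> P dvd x" "L x = int l"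
    using L_surj[of "int l"] l by force
  \<comment> \<open>The residues 1 and -1 have logarithm 0, whereas \<open>l\<close> is nonzero
    modulo \<open>n\<close>.\<close>
  have x1: "\<not> P dvd x - 1" "\<not> P dvd x + 1"
    using L_eq_0_iff[OF x(1)] x(2) l by auto
  obtain s where s: "[(x - 1) * s = 1] (mod P)" using inverse_exists[OF x1(1)] .
  obtain t where t: "[(x + 1) * t = 1] (mod P)" using inverse_exists[OF x1(2)] .
  note ns = not_P_dvd_inverse[OF s] and nt = not_P_dvd_inverse[OF t]
  have s1: "[s + 1 = x * s] (mod P)" and t1: "[1 - t = x * t] (mod P)"
    using s t by (simp_all add: cong_iff_dvd_diff algebra_simps dvd_diff_commute)
  \<comment> \<open>So \<open>2 * s + 1\<close> is \<open>(x + 1) / (x - 1)\<close> and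
    \<open>1 - 2 * t\<close> is its inverse; neither vanishes.\<close>
  have s2: "[(x - 1) * (2 * s + 1) = x + 1] (mod P)"
    and t2: "[(x + 1) * (2 * - t + 1) = x - 1] (mod P)"
  proof -
    have "(x - 1) * (2 * s + 1) - (x + 1) = 2 * ((x - 1) * s - 1)"
      "(x + 1) * (2 * - t + 1) - (x - 1) = - 2 * ((x + 1) * t - 1)"
      by (simp_all add: algebra_simps)
    then show "[(x - 1) * (2 * s + 1) = x + 1] (mod P)" "[(x + 1) * (2 * - t + 1) = x - 1] (mod P)"
      using s t unfolding cong_iff_dvd_diff by (metis dvd_mult)+
  qed
  have nds: "nondegenerate s" unfolding nondegenerate_def
    using ns(2) x(1) cong_dvd_iff[OF s1] cong_dvd_iff[OF s2] x1 by (auto simp: P_dvd_mult_iff)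
  have ndt: "nondegenerate (- t)" unfolding nondegenerate_def
    using nt(2) x(1) cong_dvd_iff[OF t1] cong_dvd_iff[OF t2] x1 by (auto simp: P_dvd_mult_iff)
  have "{e \<in> {edge a | a. nondegenerate a}. edge_length n e = plus_minus n (int l)}
      = {edge s, edge (- t)}"
  proof (intro equalityI subsetI)
    fix e assume "e \<in> {e \<in> {edge a | a. nondegenerate a}. edge_length n e = plus_minus n (int l)}"
    then obtain a where a: "e = edge a" "nondegenerate a" "edge_length n (edge a) = plus_minus n (L x)"
      using x by auto
    then show "e \<in> {edge s, edge (- t)}"
      using edge_length_edge_iff[OF a(2) x(1) s t] edge_cong edge_reflect by (metis insert_iff)
  next
    fix e assume "e \<in> {edge s, edge (- t)}"
    then show "e \<in> {e \<in> {edge a | a. nondegenerate a}. edge_length n e = plus_minus n (int l)}"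
      using edge_length_edge_iff[OF nds x(1) s t] edge_length_edge_iff[OF ndt x(1) s t] nds ndt x(2)
      by auto
  qed
  moreover have "edge s \<noteq> edge (- t)"
  proof
    assume "edge s = edge (- t)"
    \<comment> \<open>Endpoints match in order or crosswise. In order, \<open>s\<close> is
      \<open>t\<close> or \<open>- t\<close>, so \<open>x - 1\<close> is \<open>x + 1\<close> or its
      negative, giving 2 = 0 or \<open>2 * x\<close> = 0 modulo \<open>P\<close>. Crosswise,
      \<open>L s\<close> and \<open>L t\<close> each exceed the other by \<open>L x\<close>, so
      \<open>2 * L x\<close> = 0 modulo \<open>n\<close>.\<close>
    then consider "L s = L t" | "L s = L (1 - t)" "L (s + 1) = L t"
      unfolding edge_def doubleton_eq_iff by (auto simp: L_uminus)
    then show False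
    proof cases
      case 1
      then have "P dvd s - t \<or> P dvd s + t"
        using ns nt by (simp add: L_eq_iff square_cong_iff)
      moreover have "P dvd (x - 1) * s - 1" "P dvd (x + 1) * t - 1"
        using s t by (simp_all add: cong_iff_dvd_diff)
      ultimately have "P dvd 2 * t \<or> P dvd 2 * (x * t)"
      proof (elim disjE)
        assume "P dvd s - t"
        moreover have "2 * t = ((x + 1) * t - 1) - ((x - 1) * s - 1) + (x - 1) * (s - t)"
          by (simp add: algebra_simps)
        ultimately show ?thesis
          using \<open>P dvd (x - 1) * s - 1\<close> \<open>P dvd (x + 1) * t - 1\<close> by (metis dvd_add dvd_diff dvd_mult)
      next
        assume "P dvd s + t"
        moreover have "2 * (x * t) = ((x + 1) * t - 1) - ((x - 1) * s - 1) + (x - 1) * (s + t)"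
          by (simp add: algebra_simps)
        ultimately show ?thesis
          using \<open>P dvd (x - 1) * s - 1\<close> \<open>P dvd (x + 1) * t - 1\<close> by (metis dvd_add dvd_diff dvd_mult)
      qed
      then show False using nt x not_P_dvd_2 by (simp add: P_dvd_mult_iff)
    next
      case 2
      then have "L s = (L x + L t) mod int n" "(L x + L s) mod int n = L t"
        using L_cong[OF s1] L_cong[OF t1] ns nt x by (simp_all add: L_mult)
      then have "[L s = L x + L t] (mod int n)" "[L x + L s = L t] (mod int n)"
        by (simp_all add: cong_def L_mod)
      from cong_diff[OF this(2,1)] have "[2 * L x = 0] (mod int n)"
        by (simp add: cong_iff_dvd_diff algebra_simps)
      then have "[L x = 0] (mod int n)" by (simp only: two_mult_cong_0_iff)
      moreover have "0 < l" "l < n" using l by auto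
      ultimately show False using x nat_dvd_not_less by (simp add: cong_0_iff)
    qed
  qed
  ultimately show ?thesis by simp
qed

section \<open>Pairs of edges at a given distance\<close>

text \<open>Dividing by \<open>y\<close> lowers logarithms by \<open>k\<close>. Choosing
  \<open>b\<close> as \<open>- a / y\<close>, with the sign invisible to \<open>L\<close>, makes
  \<open>b + 1 = (a + 1) / y\<close> equivalent to \<open>2 * a + 1 = y\<close>; without the sign it
  would force \<open>y\<close> to be 1.\<close>

lemma ex_translated_edge:
  assumes k: "0 < k" "k < int n"
  obtains a b where "nondegenerate a" "nondegenerate b"
    "L b = (L a - k) mod int n" "L (b + 1) = (L (a + 1) - k) mod int n"
proof -
  obtain y where y: "\<not> P dvd y" "L y = k"
    using L_surj[of k] k by auto
  have y1: "\<not> P dvd y - 1" "\<not> P dvd y + 1"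
    using L_eq_0_iff[OF y(1)] y(2) k by auto
  obtain z where z: "[y * z = 1] (mod P)" using inverse_exists[OF y(1)] .
  have nz: "\<not> P dvd z" using not_P_dvd_inverse[OF z] by simp
  have yz: "P dvd y * z - 1" using z by (simp add: cong_iff_dvd_diff)
  define a where "a = (y - 1) * (int n + 1)" \<comment> \<open>\<open>n + 1\<close> is the inverse of \<open>2\<close> modulo \<open>P\<close>\<close>
  have a: "2 * a = y - 1 + P * (y - 1)" by (simp add: a_def algebra_simps)
  \<comment> \<open>Up to factors 2, these are the three values in the nondegeneracy of
    \<open>a\<close>, and \<open>P\<close> divides none of \<open>y - 1\<close>,
    \<open>y + 1\<close> and \<open>y\<close>.\<close>
  have a_cong: "[2 * a = y - 1] (mod P)" "[2 * (a + 1) = y + 1] (mod P)" "[2 * a + 1 = y] (mod P)"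
  proof -
    have "2 * a - (y - 1) = P * (y - 1)" "2 * (a + 1) - (y + 1) = P * (y - 1)"
      "2 * a + 1 - y = P * (y - 1)"
      using a by (simp_all add: distrib_left)
    then show "[2 * a = y - 1] (mod P)" "[2 * (a + 1) = y + 1] (mod P)" "[2 * a + 1 = y] (mod P)"
      unfolding cong_iff_dvd_diff by (simp_all only: dvd_triv_left)
  qed
  have nda: "nondegenerate a" unfolding nondegenerate_def
    using a_cong[THEN cong_dvd_iff] y y1
    by (auto simp: P_dvd_mult_iff simp del: distrib_left_numeral)
  define b where "b = - (a * z)"
  have na: "\<not> P dvd a" "\<not> P dvd a + 1" using nda by (auto simp: nondegenerate_def)
  have b1: "[b + 1 = (a + 1) * z] (mod P)"
  proof -
    \<comment> \<open>The last summand is 0 by the choice of \<open>a\<close>; including it makes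
      this a polynomial identity in \<open>a\<close>, \<open>y\<close> and \<open>z\<close>.\<close>
    have "b + 1 - (a + 1) * z = - (P * (y - 1) * z) - (y * z - 1) + (y - 1 + P * (y - 1) - 2 * a) * z"
      by (simp add: b_def algebra_simps)
    also have "P dvd \<dots>" using yz by (simp add: a)
    finally show ?thesis by (simp add: cong_iff_dvd_diff)
  qed
  have b2: "[2 * b + 1 = z] (mod P)"
  proof -
    have "2 * b + 1 - z = - (P * (y - 1) * z) - (y * z - 1) + (y - 1 + P * (y - 1) - 2 * a) * z"
      by (simp add: b_def algebra_simps)
    also have "P dvd \<dots>" using yz by (simp add: a)
    finally show ?thesis by (simp add: cong_iff_dvd_diff)
  qed
  have ndb: "nondegenerate b" unfolding nondegenerate_def
    using cong_dvd_iff[OF b1] cong_dvd_iff[OF b2] nz na by (simp add: P_dvd_mult_iff b_def)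
  have "(k + L z) mod int n = 0"
    using L_cong[OF z] L_mult[OF y(1) nz] y L_one by simp
  then have "[L z = - k] (mod int n)"
    by (simp add: cong_iff_dvd_diff dvd_eq_mod_eq_0 add.commute)
  then have "(L c + L z) mod int n = (L c - k) mod int n" for c
    using cong_add[OF cong_refl, of "L z" "- k" "int n" "L c"] by (simp add: cong_def)
  then have "L b = (L a - k) mod int n" "L (b + 1) = (L (a + 1) - k) mod int n"
    using L_cong[OF b1] na nz by (simp_all add: L_mult b_def L_uminus)
  with nda ndb show thesis by (rule that)
qed

end

section \<open>Terrace property and distances for the sequence of logarithms\<close>

theorem theorem2p4:
  fixes n g :: nat and c :: "nat \<Rightarrow> nat" and d :: "nat \<Rightarrow> int"
  assumes "odd n"
    and "prime (2 * n + 1)"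
    and "residue_primroot (2 * n + 1) g"
    and "\<And>i. i \<in> {1..n} \<Longrightarrow> c i = discrete_log (2 * n + 1) g i"
    and "\<And>i. i \<in> {1..n} \<Longrightarrow> d i = int (c i) mod int n"
  shows "ODC_starter n d"
proof -
  interpret odd_log n g
    using assms(1-3) by unfold_locales
  have d: "d i = L (int i)" if "i \<in> {1..n}" for i
    using assms(4,5)[OF that] that by (simp add: L_def)
  have path: "path_edges n d = {edge a | a. nondegenerate a}"
    using d by (rule path_edges_eq)
  have bij: "bij_betw d {1..n} {0..<int n}"
    using bij_betw_L bij_betw_cong[of "{1..n}" d "\<lambda>i. L (int i)", OF d] by simp
  have "terrace n d"
    unfolding terrace_def hamiltonian_path_def path
    by (intro conjI ballI odd_n bij card_edges_of_length)
  moreover have "\<exists>l\<in>{1..(n - 1) div 2}. \<exists>e\<in>path_edges n d. \<exists>f\<in>path_edges n d. e \<noteq> f \<and>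
      edge_length n e = plus_minus n (int l) \<and> edge_length n f = plus_minus n (int l) \<and>
      edges_at_distance n (int k) e f" if k: "k \<in> {1..(n - 1) div 2}" for k
  proof -
    have k_bounds: "0 < int k" "int k < int n" using k by auto
    obtain a b where ab: "nondegenerate a" "nondegenerate b"
        "L b = (L a - int k) mod int n" "L (b + 1) = (L (a + 1) - int k) mod int n"
      using ex_translated_edge[OF k_bounds] .
    have "\<not> [L (a + 1) = L a] (mod int n)"
      using L_succ_neq[OF ab(1)] by (simp add: cong_def L_mod)
    then have "\<not> [L (a + 1) - L a = 0] (mod int n)"
      by (simp add: cong_iff_dvd_diff)
    \<comment> \<open>The edge is not a loop, so its length is nonzero and has a representative in
      the required range.\<close>
    then obtain l where l: "l \<in> {1..(n - 1) div 2}" "edge_length n (edge a) = plus_minus n (int l)"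
      unfolding edge_length_edge[OF ab(1)] using ex_plus_minus_eq[OF _ odd_n] by blast
    have "[L (b + 1) - L b = (L (a + 1) - int k) - (L a - int k)] (mod int n)"
      unfolding ab(3,4) by (intro cong_diff) (simp_all add: cong_def)
    then have "edge_length n (edge b) = edge_length n (edge a)"
      by (simp add: edge_length_edge[OF ab(1)] edge_length_edge[OF ab(2)] plus_minus_eq_iff)
    \<comment> \<open>A coincidence in order gives \<open>k\<close> = 0 modulo \<open>n\<close>; a
      crosswise one gives \<open>2 * k\<close> = 0 by adding the two congruences.\<close>
    moreover have "edge a \<noteq> edge b"
    proof
      have cong: "[L b = L a - int k] (mod int n)" "[L (b + 1) = L (a + 1) - int k] (mod int n)"
        by (simp_all add: ab cong_def)
      assume "edge a = edge b"
      then consider "L b = L a" | "L b = L (a + 1)" "L (b + 1) = L a"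
        unfolding edge_def doubleton_eq_iff by auto
      then have "[int k = 0] (mod int n)"
      proof cases
        case 1
        then show ?thesis using cong(1) by (simp add: cong_iff_dvd_diff)
      next
        case 2
        then have "[2 * int k = 0] (mod int n)"
          using cong_add[OF cong] by (simp add: cong_iff_dvd_diff)
        then show ?thesis by (simp only: two_mult_cong_0_iff)
      qed
      then show False using k_bounds zdvd_not_zless unfolding cong_0_iff by blast
    qed
    \<comment> \<open>The translation is by \<open>- k\<close>, so the second disjunct of the
      definition holds.\<close>
    moreover have "edges_at_distance n (int k) (edge a) (edge b)"
      by (simp add: edges_at_distance_def translate_def edge_def ab)
    ultimately show ?thesis
      unfolding path using ab(1,2) l
      by (intro bexI[of _ l] bexI[of _ "edge a"] bexI[of _ "edge b"]) auto
  qed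
  ultimately show ?thesis unfolding ODC_starter_def by blast
qed

end
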